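(* Let $A\in\mathbb{R}^{n\times n}$, $B\in\mathbb{R}^{n\times m}$, $E\in\mathbb{R}^{m\times n}_+$ with no zero row, $s\in\mathbb{R}^n$ and $r\in\mathbb{R}^m$ be such that $A-|B|E$ is Metzler and $s\ge E^{\top}|r|$. The following are equivalent: (i) The primal linear program $$\text{maximize } \mathbf{1}^{\top}p \ \text{ over } p\in\mathbb{R}^n_+,\ \zeta\in\mathbb{R}^m_+ \quad\text{subject to } A^{\top}p\ge E^{\top}\zeta-s,\quad -\zeta\le r+B^{\top}p\le\zeta$$ has a bounded solution (finite optimal value). (ii) The dual linear program $$\text{minimize } s^{\top}x+r^{\top}u \ \text{ over } x\in\mathbb{R}^n_+,\ u\in\mathbb{R}^m \quad\text{subject to } Ax+Bu\le-\mathbf{1},\quad -Ex\le u\le Ex$$ is feasible. (iii) There exists $D\in\mathbb{R}^{m\times m}$ satisfying $-I\le D\le I$ such that $A-BDE$ is Hurwitz.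
   Context: Inequalities between vectors or matrices are elementwise (so $-I\le D\le I$ forces $D$ to be diagonal with diagonal entries in $[-1,1]$), $|X|$ denotes the elementwise absolute value, and $\mathbb{R}^n_+$, $\mathbb{R}^{m\times n}_+$ denote vectors/matrices with nonnegative entries. $\mathbf{1}$ is the all-ones vector. A square matrix is Metzler if its off-diagonal entries are nonnegative, and Hurwitz if all its eigenvalues have strictly negative real part. *)

theory Defs
  imports "HOL-Analysis.Analysis"
begin

text \<open>
  An \<open>m \<times> n\<close> matrix has type \<^typ>\<open>real ^ 'n ^ 'm\<close>. On vectors and matrices the library's order
  and absolute value are componentwise, the constant \<open>1\<close> of a vector type is the all-ones vector
  (whereas \<open>mat 1\<close> is the identity matrix), and \<open>\<bullet>\<close> is the standard inner product.
\<close>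

definition eigenvalue :: "complex ^ 'n ^ 'n \<Rightarrow> complex \<Rightarrow> bool" where
  "eigenvalue M \<mu> \<longleftrightarrow> (\<exists>v. v \<noteq> 0 \<and> M *v v = \<mu> *s v)"

definition Hurwitz :: "real ^ 'n ^ 'n \<Rightarrow> bool" where
  "Hurwitz M \<longleftrightarrow> (\<forall>\<mu>. eigenvalue (map_matrix complex_of_real M) \<mu> \<longrightarrow> Re \<mu> < 0)"

definition Metzler :: "real ^ 'n ^ 'n \<Rightarrow> bool" where
  "Metzler M \<longleftrightarrow> (\<forall>i j. i \<noteq> j \<longrightarrow> 0 \<le> M $ i $ j)"

text \<open>An optimization problem is given by its sense, objective function and feasible set.\<close>

datatype 'v optimization_problem =
    Maximize "'v \<Rightarrow> real" "'v set"
  | Minimize "'v \<Rightarrow> real" "'v set"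

fun feasible_set :: "'v optimization_problem \<Rightarrow> 'v set" where
  "feasible_set (Maximize f S) = S"
| "feasible_set (Minimize f S) = S"

definition feasible :: "'v optimization_problem \<Rightarrow> bool" where
  "feasible P \<longleftrightarrow> feasible_set P \<noteq> {}"

text \<open>
  The value is taken in the extended reals: an infeasible maximization problem has value
  \<open>- \<infinity>\<close> and an infeasible minimization problem has value \<open>\<infinity>\<close>.
\<close>

fun optimal_value :: "'v optimization_problem \<Rightarrow> ereal" where
  "optimal_value (Maximize f S) = (SUP v\<in>S. ereal (f v))"
| "optimal_value (Minimize f S) = (INF v\<in>S. ereal (f v))"

definition finite_optimal_value :: "'v optimization_problem \<Rightarrow> bool" where
  "finite_optimal_value P \<longleftrightarrow> \<bar>optimal_value P\<bar> \<noteq> \<infinity>"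

definition primal_LP ::
  "real ^ 'n ^ 'n \<Rightarrow> real ^ 'm ^ 'n \<Rightarrow> real ^ 'n ^ 'm \<Rightarrow> real ^ 'n \<Rightarrow> real ^ 'm \<Rightarrow>
    ((real ^ 'n) \<times> (real ^ 'm)) optimization_problem" where
  "primal_LP A B E s r =
    Maximize (\<lambda>(p, \<zeta>). 1 \<bullet> p)
      {(p, \<zeta>). 0 \<le> p \<and> 0 \<le> \<zeta> \<and>
        transpose A *v p \<ge> transpose E *v \<zeta> - s \<and>
        - \<zeta> \<le> r + transpose B *v p \<and> r + transpose B *v p \<le> \<zeta>}"

definition dual_LP ::
  "real ^ 'n ^ 'n \<Rightarrow> real ^ 'm ^ 'n \<Rightarrow> real ^ 'n ^ 'm \<Rightarrow> real ^ 'n \<Rightarrow> real ^ 'm \<Rightarrow>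
    ((real ^ 'n) \<times> (real ^ 'm)) optimization_problem" where
  "dual_LP A B E s r =
    Minimize (\<lambda>(x, u). s \<bullet> x + r \<bullet> u)
      {(x, u). 0 \<le> x \<and>
        A *v x + B *v u \<le> - 1 \<and>
        - (E *v x) \<le> u \<and> u \<le> E *v x}"

end

theory Submission
  imports Defs
begin

text \<open>
  The primal problem is always feasible, since \<open>(0, \<bar>r\<bar>)\<close> satisfies the constraints. Hence (i) says
  that its objective is bounded above, which weak duality derives from (ii). If the dual is
  infeasible, the cone of all \<open>A x + B u\<close> with \<open>x \<ge> 0\<close> and \<open>\<bar>u\<bar> \<le> E x\<close> misses the open negative
  orthant; a separating functional \<open>q\<close> gives the direction \<open>(q, \<bar>B\<^sup>T q\<bar>)\<close>, along which the primal
  objective is unbounded.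

  A Metzler matrix \<open>M\<close> is Hurwitz if and only if \<open>M x < 0\<close> for some \<open>x \<ge> 0\<close>. Condition (iii) is
  therefore (ii) with \<open>u = - D E x\<close>, because every \<open>A - B D E\<close> with \<open>- I \<le> D \<le> I\<close> is Metzler.
\<close>

section \<open>Metzler matrices\<close>

text \<open>The only entry of row \<open>i\<close> that may be negative, the diagonal one, is
  multiplied by \<open>w $ i = 0\<close>.\<close>

lemma Metzler_off_diagonal:
  fixes M :: "real ^ 'n ^ 'n"
  assumes "Metzler M" and "\<And>j. 0 \<le> w $ j" and "w $ i = 0"
  shows "0 \<le> (M *v w) $ i"
  unfolding matrix_vector_mult_def vec_lambda_beta
proof (rule sum_nonneg)
  fix j
  show "0 \<le> M $ i $ j * w $ j"
    using assms by (cases "i = j") (auto simp: Metzler_def)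
qed

lemma Metzler_strictly_positive:
  fixes M :: "real ^ 'n ^ 'n"
  assumes "Metzler M" and "\<And>j. 0 \<le> x $ j" and "\<And>j. (M *v x) $ j < 0"
  shows "0 < x $ i"
proof -
  have "x $ i \<noteq> 0"
    using Metzler_off_diagonal[of M x i] assms by (metis not_less)
  then show ?thesis
    using assms(2)[of i] by simp
qed

text \<open>Let \<open>c\<close> be the least ratio \<open>y $ j / x $ j\<close>, attained at
  \<open>i\<close>. Then \<open>y - c *s x\<close> is nonnegative and vanishes at \<open>i\<close>,
  so row \<open>i\<close> gives \<open>c * (M *v x) $ i \<le> (M *v y) $ i \<le> 0\<close>. This
  forces \<open>0 \<le> c\<close>, and \<open>y\<close> dominates \<open>c *s x\<close>.\<close>

lemma Metzler_monotone:
  fixes M :: "real ^ 'n ^ 'n"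
  assumes M: "Metzler M" and x: "\<And>j. 0 \<le> x $ j" "\<And>j. (M *v x) $ j < 0"
    and y: "\<And>j. (M *v y) $ j \<le> 0"
  shows "0 \<le> y $ k"
proof -
  have pos: "0 < x $ j" for j
    using Metzler_strictly_positive[OF M x] .
  obtain i where i: "\<And>j. y $ i / x $ i \<le> y $ j / x $ j"
    using ex_is_arg_min_if_finite[of UNIV "\<lambda>i. y $ i / x $ i"]
    by (auto simp: is_arg_min_linorder)
  define c where "c = y $ i / x $ i"
  have c: "c * x $ j \<le> y $ j" for j
    using i[of j] pos[of j] by (simp add: c_def pos_le_divide_eq)
  have "0 \<le> (M *v (y - c *s x)) $ i"
    by (rule Metzler_off_diagonal[OF M]) (use c pos[of i] in \<open>auto simp: c_def\<close>)
  then have "c * (M *v x) $ i \<le> 0"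
    using y[of i] by (simp add: matrix_vector_mult_diff_distrib vector_scalar_commute)
  then have "0 \<le> c"
    using x(2)[of i] by (simp add: mult_le_0_iff)
  then show ?thesis
    using c[of k] mult_nonneg_nonneg[of c "x $ k"] x(1)[of k] by linarith
qed

text \<open>Gershgorin's argument in the maximum norm weighted by \<open>x\<close>: a row
  \<open>i\<close> where \<open>norm (v $ i) / x $ i\<close> is largest puts \<open>\<mu>\<close> in
  the open disc about \<open>M $ i $ i\<close> of radius \<open>- M $ i $ i\<close>, which lies in
  the left half-plane.\<close>

lemma Metzler_imp_Hurwitz:
  fixes M :: "real ^ 'n ^ 'n"
  assumes M: "Metzler M" and x: "\<And>j. 0 \<le> x $ j" "\<And>j. (M *v x) $ j < 0"
  shows "Hurwitz M"
  unfolding Hurwitz_def eigenvalue_def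
proof (intro allI impI, elim exE conjE)
  fix \<mu> :: complex and v :: "complex ^ 'n"
  assume v: "v \<noteq> 0" and eig: "map_matrix complex_of_real M *v v = \<mu> *s v"
  have pos: "0 < x $ j" for j
    using Metzler_strictly_positive[OF M x] .
  obtain i where i: "\<And>j. norm (v $ j) / x $ j \<le> norm (v $ i) / x $ i"
    using ex_is_arg_min_if_finite[of UNIV "\<lambda>i. - (norm (v $ i) / x $ i)"]
    by (auto simp: is_arg_min_linorder)
  define c where "c = norm (v $ i) / x $ i"
  have c: "norm (v $ j) \<le> c * x $ j" for j
    using i[of j] pos[of j] by (simp add: c_def pos_divide_le_eq)
  have ci: "norm (v $ i) = c * x $ i"
    using pos[of i] by (simp add: c_def)
  obtain l where "v $ l \<noteq> 0"
    using v by (auto simp: vec_eq_iff)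
  then have "0 < c * x $ l"
    using c[of l] by (meson less_le_trans zero_less_norm_iff)
  then have cpos: "0 < c"
    using pos[of l] by (simp add: zero_less_mult_iff)
  have "(\<Sum>j\<in>UNIV. of_real (M $ i $ j) * v $ j) = \<mu> * v $ i"
    using arg_cong[OF eig, of "\<lambda>w. w $ i"]
    by (simp add: matrix_vector_mult_def map_matrix_def)
  then have "(\<mu> - of_real (M $ i $ i)) * v $ i = (\<Sum>j\<in>UNIV - {i}. of_real (M $ i $ j) * v $ j)"
    by (simp add: sum.remove[of UNIV i] algebra_simps)
  then have "norm (\<mu> - of_real (M $ i $ i)) * norm (v $ i)
      \<le> (\<Sum>j\<in>UNIV - {i}. norm (of_real (M $ i $ j) * v $ j))"
    by (metis norm_mult norm_sum)
  also have "\<dots> \<le> (\<Sum>j\<in>UNIV - {i}. M $ i $ j * (c * x $ j))"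
    using M c by (intro sum_mono) (auto simp: norm_mult Metzler_def intro!: mult_mono)
  also have "\<dots> = c * (\<Sum>j\<in>UNIV - {i}. M $ i $ j * x $ j)"
    by (simp add: sum_distrib_left mult.left_commute)
  \<comment> \<open>This is row \<open>i\<close> of \<open>M x < 0\<close> with the diagonal term
    moved to the right.\<close>
  also have "\<dots> < c * (- M $ i $ i * x $ i)"
    using x(2)[of i] cpos
    by (intro mult_strict_left_mono) (auto simp: matrix_vector_mult_def sum.remove[of UNIV i])
  finally have "norm (\<mu> - of_real (M $ i $ i)) * (c * x $ i) < - M $ i $ i * (c * x $ i)"
    by (simp add: ci mult.left_commute)
  then have "norm (\<mu> - of_real (M $ i $ i)) < - M $ i $ i"
    by (rule mult_right_less_imp_less) (use cpos pos[of i] in simp)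
  then show "Re \<mu> < 0"
    using complex_Re_le_cmod[of "\<mu> - of_real (M $ i $ i)"] by simp
qed

text \<open>A nonnegative \<open>t\<close> is not an eigenvalue of \<open>M\<close>, so the shifted
  map is injective and, in finite dimension, surjective.\<close>

lemma Hurwitz_shift_surj:
  fixes M :: "real ^ 'n ^ 'n"
  assumes "Hurwitz M" and "0 \<le> t"
  obtains x where "M *v x - t *s x = b"
proof -
  let ?f = "\<lambda>x. M *v x - t *s x"
  have lin: "linear ?f"
    unfolding scalar_mult_eq_scaleR
    by (intro linear_compose_sub matrix_vector_mul_linear linear_scale_self)
  have "inj ?f"
  proof (subst linear_injective_0[OF lin], intro allI impI, rule ccontr)
    fix v :: "real ^ 'n"
    assume v: "M *v v - t *s v = 0" "v \<noteq> 0"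
    \<comment> \<open>A real kernel vector, read over the complex numbers, is an eigenvector for
      \<open>t\<close>.\<close>
    define w :: "complex ^ 'n" where "w = (\<chi> i. of_real (v $ i))"
    have "w \<noteq> 0"
      using v(2) by (auto simp: w_def vec_eq_iff)
    moreover have "map_matrix complex_of_real M *v w = complex_of_real t *s w"
      using v(1)
      by (simp add: vec_eq_iff w_def matrix_vector_mult_def map_matrix_def
          flip: of_real_mult of_real_sum)
    ultimately have "Re (complex_of_real t) < 0"
      using assms(1) unfolding Hurwitz_def eigenvalue_def by blast
    then show False
      using assms(2) by simp
  qed
  then have "surj ?f"
    by (rule linear_inj_imp_surj[OF lin])
  then obtain x where "b = ?f x"
    by (rule surjE)
  then show thesis
    by (intro that[of x]) (rule sym)
qed

text \<open>
  The idea is to lower \<open>t\<close> from a large value to 0 while \<open>M - t I\<close> keeps a certificate, that is,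
  some \<open>x \<ge> 0\<close> with \<open>(M - t I) x < 0\<close>. At the infimum \<open>t\<close> the equation \<open>(M - t I) x = - 1\<close> has a
  solution, because \<open>t\<close> is not an eigenvalue. This \<open>x\<close> is nonnegative by monotonicity of a slightly
  larger shift, and it is still a certificate for a slightly smaller one.
\<close>

lemma Hurwitz_imp_certificate:
  fixes M :: "real ^ 'n ^ 'n"
  assumes M: "Metzler M" and H: "Hurwitz M"
  obtains x where "\<And>j. 0 \<le> x $ j" "M *v x = - 1"
proof -
  define T where "T = {t. 0 \<le> t \<and> (\<exists>x. \<forall>j. 0 \<le> x $ j \<and> (M *v x - t *s x) $ j < 0)}"
  have bdd: "bdd_below T"
    by (rule bdd_belowI[of _ 0]) (auto simp: T_def)
  \<comment> \<open>\<open>t1\<close> exceeds every entry of \<open>M *v 1\<close>, so the all-ones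
    vector is a certificate for the shift \<open>t1\<close>.\<close>
  define t1 where "t1 = 1 + (\<Sum>j\<in>UNIV. \<bar>(M *v 1) $ j\<bar>)"
  have "(M *v 1) $ j < t1" for j
    using member_le_sum[of j UNIV "\<lambda>j. \<bar>(M *v 1) $ j\<bar>"] by (simp add: t1_def)
  then have "t1 \<in> T"
    by (auto simp: T_def t1_def sum_nonneg add_nonneg_nonneg intro!: exI[of _ 1])
  then have ne: "T \<noteq> {}"
    by auto
  define t where "t = Inf T"
  have t0: "0 \<le> t"
    unfolding t_def by (rule cInf_greatest[OF ne]) (auto simp: T_def)
  obtain x where x: "M *v x - t *s x = - 1"
    using Hurwitz_shift_surj[OF H t0] .
  \<comment> \<open>Changing the shift by at most \<open>e\<close> alters each coordinate of
    \<open>(M - t I) x = - 1\<close> by less than 1, so all of them stay negative.\<close>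
  define e where "e = 1 / (1 + (\<Sum>j\<in>UNIV. \<bar>x $ j\<bar>))"
  have e: "0 < e"
    by (simp add: e_def add_pos_nonneg sum_nonneg)
  have ex: "e' * \<bar>x $ j\<bar> < 1" if "0 \<le> e'" "e' \<le> e" for e' j
  proof -
    have "\<bar>x $ j\<bar> < 1 + (\<Sum>j\<in>UNIV. \<bar>x $ j\<bar>)"
      using member_le_sum[of j UNIV "\<lambda>j. \<bar>x $ j\<bar>"] by simp
    then have "e * \<bar>x $ j\<bar> < 1"
      by (simp add: e_def divide_less_eq)
    then show ?thesis
      using mult_right_mono[OF that(2), of "\<bar>x $ j\<bar>"] by simp
  qed
  obtain t' where t': "t' \<in> T" "t' < t + e"
    using cInf_lessD[OF ne, of "t + e"] e by (auto simp: t_def)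
  then have tt': "t \<le> t'"
    using bdd by (simp add: t_def cInf_lower)
  obtain z where z: "\<And>j. 0 \<le> z $ j" "\<And>j. (M *v z - t' *s z) $ j < 0"
    using t'(1) by (auto simp: T_def)
  let ?N = "M - t' *\<^sub>R mat 1"
  have N: "?N *v w = M *v w - t' *s w" for w
    by (simp add: matrix_vector_mult_diff_rdistrib scaleR_matrix_vector_assoc[symmetric]
        scalar_mult_eq_scaleR)
  have "Metzler ?N"
    using M by (simp add: Metzler_def mat_def)
  moreover have "(?N *v x) $ j \<le> 0" for j
  proof -
    have "\<bar>(t' - t) * x $ j\<bar> < 1"
      using ex[of "t' - t" j] tt' t'(2) by (simp add: abs_mult)
    moreover have "(?N *v x) $ j = - 1 - (t' - t) * x $ j"
      using arg_cong[OF x, of "\<lambda>w. w $ j"] unfolding N by (simp add: algebra_simps)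
    ultimately show ?thesis
      by linarith
  qed
  ultimately have x0: "0 \<le> x $ j" for j
    using Metzler_monotone[of ?N z x j] z by (simp add: N)
  have "t = 0"
  proof (rule ccontr)
    assume "t \<noteq> 0"
    \<comment> \<open>The cap at \<open>t\<close> keeps \<open>t - d\<close> nonnegative, as
      membership in \<open>T\<close> demands.\<close>
    define d where "d = min e t"
    have d: "0 < d" "d \<le> e" "d \<le> t"
      using e t0 \<open>t \<noteq> 0\<close> by (auto simp: d_def)
    have "(M *v x - (t - d) *s x) $ j < 0" for j
      using ex[of d j] d x0[of j] arg_cong[OF x, of "\<lambda>w. w $ j"] by (simp add: algebra_simps)
    then have "t - d \<in> T"
      using d x0 unfolding T_def by (intro CollectI conjI exI[of _ x]) auto
    then have "t \<le> t - d"
      unfolding t_def using bdd by (rule cInf_lower)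
    then show False
      using d by simp
  qed
  then have "M *v x = - 1"
    using x by (simp only: vector_smult_lzero diff_zero)
  with x0 show thesis
    by (rule that)
qed

section \<open>The linear programs\<close>

text \<open>A hyperplane separates \<open>C\<close> from the open negative orthant. By approximation
  its inequality extends to the closed orthant, where the origin yields \<open>0 \<le> b\<close> and
  the negative unit vectors yield the signs of \<open>q\<close>.\<close>

lemma separation_from_negative_orthant:
  fixes C :: "(real ^ 'n) set"
  assumes "convex C" and "0 \<in> C" and neg: "\<And>y. y \<in> C \<Longrightarrow> \<exists>i. 0 \<le> y $ i"
  obtains q where "q \<noteq> 0" "\<And>i. 0 \<le> q $ i" "\<And>y. y \<in> C \<Longrightarrow> 0 \<le> q \<bullet> y"
proof -
  define N :: "(real ^ 'n) set" where "N = {y. \<forall>i. y $ i < 0}"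
  have "convex N"
  proof -
    have "N = (\<Inter>i. {y. axis i 1 \<bullet> y < 0})"
      by (auto simp: N_def inner_axis')
    then show ?thesis
      by (simp only: convex_INT convex_halfspace_lt)
  qed
  moreover have "- 1 \<in> N"
    by (simp add: N_def)
  moreover have "N \<inter> C = {}"
  proof -
    have False if y: "y \<in> N" "y \<in> C" for y
    proof -
      obtain i where "0 \<le> y $ i"
        using neg[OF y(2)] by blast
      moreover have "y $ i < 0"
        using y(1) by (simp add: N_def)
      ultimately show False
        by simp
    qed
    then show ?thesis
      by blast
  qed
  ultimately obtain q b where q: "q \<noteq> 0" "\<And>y. y \<in> N \<Longrightarrow> q \<bullet> y \<le> b" "\<And>y. y \<in> C \<Longrightarrow> b \<le> q \<bullet> y"
    using separating_hyperplane_sets[of N C] assms(1,2) by blast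
  have b: "b \<le> 0"
    using q(3)[OF assms(2)] by simp
  have nonpos: "q \<bullet> y \<le> b" if "\<And>i. y $ i \<le> 0" for y
  proof (rule field_le_epsilon)
    fix e :: real
    assume e: "0 < e"
    \<comment> \<open>Moving \<open>y\<close> by \<open>- d\<close> in every coordinate reaches the
      open orthant and changes \<open>q \<bullet> y\<close> by at most \<open>e\<close>.\<close>
    define d where "d = e / (1 + \<bar>q \<bullet> 1\<bar>)"
    have d: "0 < d"
      using e by (simp add: d_def add_pos_nonneg)
    have "d * \<bar>q \<bullet> 1\<bar> \<le> e"
      using e by (simp add: d_def divide_le_eq mult_left_mono)
    moreover have "d * (q \<bullet> 1) \<le> d * \<bar>q \<bullet> 1\<bar>"
      using d by (intro mult_left_mono) auto
    moreover have "y - d *\<^sub>R 1 \<in> N"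
      using le_less_trans[OF that d] by (simp add: N_def)
    then have "q \<bullet> y - d * (q \<bullet> 1) \<le> b"
      using q(2)[of "y - d *\<^sub>R 1"] by (simp add: inner_diff_right)
    ultimately show "q \<bullet> y \<le> b + e"
      by linarith
  qed
  show thesis
  proof
    show "q \<noteq> 0"
      by (fact q)
    show "0 \<le> q $ i" for i
    proof -
      have "q \<bullet> - axis i 1 \<le> b"
        by (rule nonpos) (simp add: axis_def)
      then show ?thesis
        using b by (simp add: inner_axis)
    qed
    show "0 \<le> q \<bullet> y" if "y \<in> C" for y
      using nonpos[of 0] q(3)[OF that] by simp
  qed
qed

lemma inner_transpose:
  fixes M :: "real ^ 'a ^ 'b"
  shows "(transpose M *v p) \<bullet> x = p \<bullet> (M *v x)"
  by (simp add: dot_lmul_matrix)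

lemma inner_mono_nonneg:
  fixes x y z :: "real ^ 'a"
  assumes "0 \<le> z" "x \<le> y"
  shows "x \<bullet> z \<le> y \<bullet> z"
  using assms by (auto simp: inner_vec_def less_eq_vec_def intro!: sum_mono mult_right_mono)

lemma inner_bound:
  fixes v u z w :: "real ^ 'a"
  assumes "- z \<le> v" "v \<le> z" "- w \<le> u" "u \<le> w"
  shows "- (v \<bullet> u) \<le> z \<bullet> w"
  unfolding inner_vec_def sum_negf[symmetric]
proof (rule sum_mono)
  fix i
  have "\<bar>v $ i\<bar> \<le> z $ i" "\<bar>u $ i\<bar> \<le> w $ i"
    using assms by (auto simp: less_eq_vec_def abs_le_iff minus_le_iff)
  then have "\<bar>v $ i * u $ i\<bar> \<le> z $ i * w $ i"
    unfolding abs_mult by (intro mult_mono) auto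
  then show "- (v $ i \<bullet> u $ i) \<le> z $ i \<bullet> w $ i"
    by simp
qed

lemma matrix_vector_nonneg:
  fixes M :: "real ^ 'a ^ 'b"
  assumes "0 \<le> M" "0 \<le> x"
  shows "0 \<le> M *v x"
  using assms by (auto simp: less_eq_vec_def matrix_vector_mult_def intro!: sum_nonneg)

text \<open>Pair the dual constraint with \<open>p\<close> and the primal one with \<open>x\<close>,
  bound \<open>(r + transpose B *v p) \<bullet> u\<close> below by
  \<open>- (\<zeta> \<bullet> (E *v x))\<close>, and add the three inequalities.\<close>

lemma weak_duality:
  fixes A :: "real ^ 'n ^ 'n" and B :: "real ^ 'm ^ 'n" and E :: "real ^ 'n ^ 'm"
  assumes p: "0 \<le> p" "transpose E *v \<zeta> - s \<le> transpose A *v p"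
      "- \<zeta> \<le> r + transpose B *v p" "r + transpose B *v p \<le> \<zeta>"
    and x: "0 \<le> x" "A *v x + B *v u \<le> - 1" "- (E *v x) \<le> u" "u \<le> E *v x"
  shows "1 \<bullet> p \<le> s \<bullet> x + r \<bullet> u"
proof -
  have "(A *v x + B *v u) \<bullet> p \<le> - 1 \<bullet> p"
    using p(1) x(2) by (rule inner_mono_nonneg)
  then have "1 \<bullet> p \<le> - (p \<bullet> (A *v x)) - p \<bullet> (B *v u)"
    by (simp add: inner_add_right inner_add_left inner_commute)
  moreover have "\<zeta> \<bullet> (E *v x) - s \<bullet> x \<le> p \<bullet> (A *v x)"
    using inner_mono_nonneg[OF x(1) p(2)] by (simp add: inner_diff_left dot_lmul_matrix)
  moreover have "- (r \<bullet> u) - p \<bullet> (B *v u) \<le> \<zeta> \<bullet> (E *v x)"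
    using inner_bound[OF p(3,4) x(3,4)] by (simp add: inner_add_left dot_lmul_matrix)
  ultimately show ?thesis
    by linarith
qed

text \<open>A Farkas alternative. Testing the separating functional on the unit vector
  \<open>x = axis j 1\<close> with the worst admissible \<open>u\<close> gives coordinate
  \<open>j\<close> of the last inequality.\<close>

lemma dual_infeasible_imp_direction:
  fixes A :: "real ^ 'n ^ 'n" and B :: "real ^ 'm ^ 'n" and E :: "real ^ 'n ^ 'm"
  assumes E: "0 \<le> E"
    and infeasible: "\<nexists>x u. 0 \<le> x \<and> A *v x + B *v u \<le> - 1 \<and> - (E *v x) \<le> u \<and> u \<le> E *v x"
  obtains q where "0 \<le> q" "0 < 1 \<bullet> q" "transpose E *v \<bar>transpose B *v q\<bar> \<le> transpose A *v q"
proof -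
  define K where "K = {(x, u). 0 \<le> x \<and> - (E *v x) \<le> u \<and> u \<le> E *v x}"
  define f where "f = (\<lambda>(x, u). A *v x + B *v u)"
  have lin: "linear f"
    by (auto simp: f_def linear_iff matrix_vector_right_distrib matrix_vector_mult_scaleR
        scaleR_add_right)
  have scale: "(a *\<^sub>R x, a *\<^sub>R u) \<in> K" if "0 \<le> a" "(x, u) \<in> K" for a x u
    using that scaleR_left_mono[of "- (E *v x)" u a] scaleR_left_mono[of u "E *v x" a]
      scaleR_left_mono[of 0 x a]
    by (auto simp: K_def matrix_vector_mult_scaleR)
  have add: "(x + x', u + u') \<in> K" if "(x, u) \<in> K" "(x', u') \<in> K" for x u x' u'
    using that add_mono[of "- (E *v x)" u "- (E *v x')" u'] add_mono[of u "E *v x" u' "E *v x'"]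
    by (auto simp: K_def matrix_vector_right_distrib)
  have "convex K"
    by (auto simp: convex_def intro!: add scale)
  then have "convex (f ` K)"
    by (rule convex_linear_image[OF lin])
  moreover have "0 \<in> f ` K"
    by (rule image_eqI[of _ _ "(0, 0)"]) (auto simp: f_def K_def)
  moreover have "\<exists>i. 0 \<le> y $ i" if y: "y \<in> f ` K" for y
  proof (rule ccontr)
    assume "\<nexists>i. 0 \<le> y $ i"
    then have neg: "y $ i < 0" for i
      by (meson not_le)
    obtain x u where xu: "(x, u) \<in> K" "y = A *v x + B *v u"
      using y by (auto simp: f_def)
    \<comment> \<open>The largest \<open>1 / \<bar>y $ i\<bar>\<close>: scaling by \<open>a\<close>
      pushes every coordinate of \<open>y\<close> to at most -1, which would make the dual
      feasible.\<close>
    define a where "a = Max (range (\<lambda>i. - 1 / y $ i))"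
    have a: "- 1 / y $ i \<le> a" for i
      by (auto simp: a_def)
    have pos: "0 < - 1 / y $ i" for i
      using neg[of i] by simp
    have "0 \<le> a"
      using a pos by (meson less_imp_le order_trans)
    moreover have "A *v (a *\<^sub>R x) + B *v (a *\<^sub>R u) \<le> - 1"
    proof -
      have "a *\<^sub>R y \<le> - 1"
        using a[unfolded neg_divide_le_eq[OF neg]] by (simp add: less_eq_vec_def)
      then show ?thesis
        by (simp add: xu(2) matrix_vector_mult_scaleR scaleR_add_right)
    qed
    ultimately show False
      using infeasible scale[OF _ xu(1)] by (auto simp: K_def)
  qed
  ultimately obtain q where q: "q \<noteq> 0" "\<And>i. 0 \<le> q $ i" "\<And>y. y \<in> f ` K \<Longrightarrow> 0 \<le> q \<bullet> y"
    using separation_from_negative_orthant[of "f ` K"] by blast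
  show thesis
  proof
    show "0 \<le> q"
      using q(2) by (simp add: less_eq_vec_def)
    obtain k where "q $ k \<noteq> 0"
      using q(1) by (auto simp: vec_eq_iff)
    then have "0 < (\<Sum>i\<in>UNIV. q $ i)"
      using q(2) by (intro sum_pos2[of _ k]) (auto simp: less_le)
    then show "0 < 1 \<bullet> q"
      by (simp add: inner_vec_def)
    have "(transpose E *v \<bar>transpose B *v q\<bar>) $ j \<le> (transpose A *v q) $ j" for j
    proof -
      define x :: "real ^ 'n" where "x = axis j 1"
      \<comment> \<open>the admissible \<open>u\<close> that minimizes \<open>q \<bullet> (B u)\<close>\<close>
      define u where "u = (\<chi> i. - sgn ((transpose B *v q) $ i) * (E *v x) $ i)"
      have x: "0 \<le> x"
        by (simp add: x_def less_eq_vec_def axis_def)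
      then have Ex: "0 \<le> (E *v x) $ i" for i
        using matrix_vector_nonneg[OF E] by (simp add: less_eq_vec_def)
      have "(x, u) \<in> K"
        using x Ex by (auto simp: K_def less_eq_vec_def u_def sgn_real_def)
      then have "f (x, u) \<in> f ` K"
        by (rule imageI)
      then have "0 \<le> q \<bullet> (A *v x + B *v u)"
        using q(3)[of "f (x, u)"] by (simp add: f_def)
      also have "\<dots> = (transpose A *v q) \<bullet> x + (transpose B *v q) \<bullet> u"
        by (simp only: inner_add_right inner_transpose)
      also have "(transpose B *v q) \<bullet> u = - (\<bar>transpose B *v q\<bar> \<bullet> (E *v x))"
        by (simp add: inner_vec_def u_def sum_negf[symmetric] mult.assoc[symmetric]
            abs_sgn[symmetric] abs_vec_def)
      also have "\<bar>transpose B *v q\<bar> \<bullet> (E *v x) = (transpose E *v \<bar>transpose B *v q\<bar>) \<bullet> x"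
        by (simp only: inner_transpose)
      finally show ?thesis
        by (simp add: x_def inner_axis)
    qed
    then show "transpose E *v \<bar>transpose B *v q\<bar> \<le> transpose A *v q"
      by (simp add: less_eq_vec_def)
  qed
qed

text \<open>The assumption on \<open>s\<close> covers the base point
  \<open>(0, \<bar>r\<bar>)\<close>, \<open>dir\<close> covers the direction, and the triangle
  inequality gives the two-sided bound on their sum.\<close>

lemma primal_feasible_ray:
  fixes A :: "real ^ 'n ^ 'n" and B :: "real ^ 'm ^ 'n" and E :: "real ^ 'n ^ 'm"
  assumes s: "transpose E *v \<bar>r\<bar> \<le> s" and q: "0 \<le> q"
    and dir: "transpose E *v \<bar>transpose B *v q\<bar> \<le> transpose A *v q" and t: "0 \<le> t"
  shows "(t *\<^sub>R q, \<bar>r\<bar> + t *\<^sub>R \<bar>transpose B *v q\<bar>) \<in> feasible_set (primal_LP A B E s r)"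
proof -
  have "0 \<le> t *\<^sub>R q"
    using q t by (simp add: scaleR_nonneg_nonneg)
  moreover have "transpose E *v (\<bar>r\<bar> + t *\<^sub>R \<bar>transpose B *v q\<bar>) - s \<le> transpose A *v (t *\<^sub>R q)"
    using s scaleR_left_mono[OF dir t]
    by (simp add: matrix_vector_right_distrib matrix_vector_mult_scaleR less_eq_vec_def)
      (smt (verit))
  moreover have "\<bar>(r + transpose B *v (t *\<^sub>R q)) $ i\<bar> \<le> (\<bar>r\<bar> + t *\<^sub>R \<bar>transpose B *v q\<bar>) $ i" for i
    using t abs_triangle_ineq[of "r $ i" "t * (transpose B *v q) $ i"]
    by (simp add: matrix_vector_mult_scaleR abs_mult abs_vec_def)
  then have "- (\<bar>r\<bar> + t *\<^sub>R \<bar>transpose B *v q\<bar>) \<le> r + transpose B *v (t *\<^sub>R q)"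
      "r + transpose B *v (t *\<^sub>R q) \<le> \<bar>r\<bar> + t *\<^sub>R \<bar>transpose B *v q\<bar>"
    unfolding less_eq_vec_def vector_uminus_component by (meson abs_le_D1 abs_le_D2 minus_le_iff)+
  moreover have "0 \<le> \<bar>r\<bar> + t *\<^sub>R \<bar>transpose B *v q\<bar>"
    using t by (simp add: scaleR_nonneg_nonneg)
  ultimately show ?thesis
    unfolding primal_LP_def by simp
qed

theorem primal_finite_iff_dual_feasible:
  fixes A :: "real ^ 'n ^ 'n" and B :: "real ^ 'm ^ 'n" and E :: "real ^ 'n ^ 'm"
  assumes E: "0 \<le> E" and s: "transpose E *v \<bar>r\<bar> \<le> s"
  shows "finite_optimal_value (primal_LP A B E s r) \<longleftrightarrow> feasible (dual_LP A B E s r)"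
proof
  let ?S = "feasible_set (primal_LP A B E s r)"
  have opt: "optimal_value (primal_LP A B E s r) = (SUP v\<in>?S. ereal (1 \<bullet> fst v))"
    by (simp add: primal_LP_def case_prod_unfold)
  {
    assume fin: "finite_optimal_value (primal_LP A B E s r)"
    show "feasible (dual_LP A B E s r)"
    proof (rule ccontr)
      assume "\<not> feasible (dual_LP A B E s r)"
      then obtain q where q: "0 \<le> q" "0 < 1 \<bullet> q"
          "transpose E *v \<bar>transpose B *v q\<bar> \<le> transpose A *v q"
        using dual_infeasible_imp_direction[OF E, of A B]
        by (auto simp: feasible_def dual_LP_def)
      have "(SUP v\<in>?S. ereal (1 \<bullet> fst v)) = \<infinity>"

      proof (rule SUP_PInfty)
        fix n :: nat
        \<comment> \<open>At this multiple of \<open>q\<close> the primal objective equals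
          \<open>n\<close>.\<close>
        have "(real n / (1 \<bullet> q)) *\<^sub>R q \<in> fst ` ?S"
          using primal_feasible_ray[OF s q(1,3), of "real n / (1 \<bullet> q)"] q(2) by force
        then show "\<exists>v\<in>?S. ereal (real n) \<le> ereal (1 \<bullet> fst v)"
          using q(2) by force
      qed
      then show False
        using fin by (simp add: finite_optimal_value_def opt)
    qed
  next
    assume "feasible (dual_LP A B E s r)"
    then obtain x u where xu: "0 \<le> x" "A *v x + B *v u \<le> - 1" "- (E *v x) \<le> u" "u \<le> E *v x"
      by (auto simp: feasible_def dual_LP_def)
    have "(SUP v\<in>?S. ereal (1 \<bullet> fst v)) \<le> ereal (s \<bullet> x + r \<bullet> u)"
      using weak_duality[OF _ _ _ _ xu]
      by (intro SUP_least) (auto simp: primal_LP_def)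
    \<comment> \<open>The start of the ray is a feasible point, which excludes the value
      \<open>- \<infinity>\<close>.\<close>
    moreover have "(0, \<bar>r\<bar>) \<in> ?S"
      using primal_feasible_ray[OF s, of 0 B A 0] by simp
    then have "ereal 0 \<le> (SUP v\<in>?S. ereal (1 \<bullet> fst v))"
      by (intro SUP_upper2) auto
    ultimately show "finite_optimal_value (primal_LP A B E s r)"
      unfolding finite_optimal_value_def opt by auto
  }
qed

section \<open>Bounded diagonal feedback\<close>

text \<open>Off the diagonal both bounds on \<open>D\<close> are 0; on it they are -1 and 1.\<close>

lemma bounded_diagonal_matrix_vector:
  fixes D :: "real ^ 'm ^ 'm"
  assumes "- mat 1 \<le> D" "D \<le> mat 1"
  shows "(D *v y) $ i = D $ i $ i * y $ i" and "\<bar>D $ i $ i\<bar> \<le> 1"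
proof -
  have le: "- (mat 1 $ i $ j) \<le> D $ i $ j" "D $ i $ j \<le> mat 1 $ i $ j" for j
    using assms by (auto simp: less_eq_vec_def)
  have "D $ i $ j = 0" if "j \<noteq> i" for j
    using le[of j] that by (simp add: mat_def)
  then show "(D *v y) $ i = D $ i $ i * y $ i"
    unfolding matrix_vector_mult_def by (simp add: sum.remove[of UNIV i])
  show "\<bar>D $ i $ i\<bar> \<le> 1"
    using le[of i] by (simp add: mat_def abs_le_iff)
qed

text \<open>Since \<open>E\<close> is nonnegative and the diagonal of \<open>D\<close> lies in
  [-1, 1], replacing \<open>\<bar>B\<bar>\<close> by \<open>B ** D\<close> can only raise the
  entries of the difference.\<close>

lemma Metzler_feedback:
  fixes A :: "real ^ 'n ^ 'n" and B :: "real ^ 'm ^ 'n" and E :: "real ^ 'n ^ 'm"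
  assumes E: "0 \<le> E" and M: "Metzler (A - \<bar>B\<bar> ** E)"
    and D: "- mat 1 \<le> D" "D \<le> mat 1"
  shows "Metzler (A - B ** D ** E)"
proof -
  have "(B ** D ** E) $ i $ j \<le> (\<bar>B\<bar> ** E) $ i $ j" for i j
  proof -
    \<comment> \<open>Reading off column \<open>j\<close> turns the triple product into successive
      matrix-vector products, where the diagonal action of \<open>D\<close> applies.\<close>
    have "(B ** D ** E) $ i $ j = ((B ** D ** E) *v axis j 1) $ i"
      by (simp only: matrix_vector_mult_basis column_def vec_lambda_beta)
    also have "\<dots> = (B *v (D *v (E *v axis j 1))) $ i"
      by (simp only: matrix_vector_mul_assoc matrix_mul_assoc)
    also have "\<dots> = (\<Sum>k\<in>UNIV. B $ i $ k * (D $ k $ k * E $ k $ j))"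
      unfolding matrix_vector_mult_def[of B]
      by (simp add: bounded_diagonal_matrix_vector(1)[OF D] matrix_vector_mult_basis column_def)
    also have "\<dots> \<le> (\<Sum>k\<in>UNIV. \<bar>B $ i $ k\<bar> * E $ k $ j)"
    proof (rule sum_mono)
      fix k
      have Ekj: "0 \<le> E $ k $ j"
        using E by (simp add: less_eq_vec_def)
      have "\<bar>B $ i $ k * D $ k $ k\<bar> \<le> \<bar>B $ i $ k\<bar>"
        using bounded_diagonal_matrix_vector(2)[OF D, of k]
        by (simp add: abs_mult mult_left_le)
      then show "B $ i $ k * (D $ k $ k * E $ k $ j) \<le> \<bar>B $ i $ k\<bar> * E $ k $ j"
        using mult_right_mono[OF _ Ekj, of "B $ i $ k * D $ k $ k" "\<bar>B $ i $ k\<bar>"]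
        by (simp add: mult.assoc)
    qed
    finally show ?thesis
      by (simp add: matrix_matrix_mult_def abs_vec_def)
  qed
  then show ?thesis
    using M unfolding Metzler_def by simp (meson order_trans)
qed

lemma feedback_matrix_vector:
  fixes A :: "real ^ 'n ^ 'n" and B :: "real ^ 'm ^ 'n" and E :: "real ^ 'n ^ 'm"
  shows "(A - B ** D ** E) *v x = A *v x + B *v (- (D *v (E *v x)))"
  by (simp add: matrix_vector_mult_diff_rdistrib matrix_vector_mul_assoc matrix_mul_assoc
      linear_neg[OF matrix_vector_mul_linear])

theorem dual_feasible_iff_Hurwitz:
  fixes A :: "real ^ 'n ^ 'n" and B :: "real ^ 'm ^ 'n" and E :: "real ^ 'n ^ 'm"
  assumes E: "0 \<le> E" and M: "Metzler (A - \<bar>B\<bar> ** E)"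
  shows "feasible (dual_LP A B E s r) \<longleftrightarrow>
    (\<exists>D :: real ^ 'm ^ 'm. - mat 1 \<le> D \<and> D \<le> mat 1 \<and> Hurwitz (A - B ** D ** E))"
proof
  assume "feasible (dual_LP A B E s r)"
  then obtain x u where xu: "0 \<le> x" "A *v x + B *v u \<le> - 1" "- (E *v x) \<le> u" "u \<le> E *v x"
    by (auto simp: feasible_def dual_LP_def)
  let ?y = "E *v x"
  have u: "\<bar>u $ i\<bar> \<le> ?y $ i" for i
    using xu(3,4) by (auto simp: less_eq_vec_def abs_le_iff minus_le_iff)
  \<comment> \<open>Where \<open>(E x)\<^sub>i = 0\<close> also \<open>u\<^sub>i = 0\<close>, and division by zero gives the diagonal entry 0.\<close>
  define D :: "real ^ 'm ^ 'm" where "D = (\<chi> i j. if i = j then - u $ i / ?y $ i else 0)"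
  have le1: "\<bar>u $ i / ?y $ i\<bar> \<le> 1" for i
    using u[of i] by (auto simp: divide_le_eq_1)
  have "u $ i / ?y $ i \<le> 1" "- 1 \<le> u $ i / ?y $ i" for i
    using le1[of i] by linarith+
  then have D: "- mat 1 \<le> D" "D \<le> mat 1"
    by (auto simp: less_eq_vec_def D_def mat_def)
  have "(D *v ?y) $ i = - u $ i" for i
    using u[of i] unfolding bounded_diagonal_matrix_vector(1)[OF D] by (auto simp: D_def)
  then have "- (D *v ?y) = u"
    by (simp add: vec_eq_iff)
  then have "(A - B ** D ** E) *v x \<le> - 1"
    using xu(2) by (simp add: feedback_matrix_vector)
  then have "((A - B ** D ** E) *v x) $ j < 0" for j
    by (auto simp: less_eq_vec_def intro: le_less_trans[of _ "- 1"])
  then have "Hurwitz (A - B ** D ** E)"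
    using xu(1) by (intro Metzler_imp_Hurwitz[OF Metzler_feedback[OF E M D], of x])
      (auto simp: less_eq_vec_def)
  then show "\<exists>D :: real ^ 'm ^ 'm. - mat 1 \<le> D \<and> D \<le> mat 1 \<and> Hurwitz (A - B ** D ** E)"
    using D by blast
next
  assume "\<exists>D :: real ^ 'm ^ 'm. - mat 1 \<le> D \<and> D \<le> mat 1 \<and> Hurwitz (A - B ** D ** E)"
  then obtain D :: "real ^ 'm ^ 'm" where D: "- mat 1 \<le> D" "D \<le> mat 1"
      and H: "Hurwitz (A - B ** D ** E)"
    by blast
  obtain x where x: "\<And>j. 0 \<le> x $ j" "(A - B ** D ** E) *v x = - 1"
    using Hurwitz_imp_certificate[OF Metzler_feedback[OF E M D] H] by blast
  have x0: "0 \<le> x"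
    using x(1) by (simp add: less_eq_vec_def)
  let ?u = "- (D *v (E *v x))"
  have "\<bar>?u $ i\<bar> \<le> (E *v x) $ i" for i
  proof -
    have "0 \<le> (E *v x) $ i"
      using matrix_vector_nonneg[OF E x0] by (simp add: less_eq_vec_def)
    then show ?thesis
      using bounded_diagonal_matrix_vector(1)[OF D, of "E *v x" i]
        bounded_diagonal_matrix_vector(2)[OF D, of i]
      by (simp add: abs_mult mult_left_le_one_le)
  qed
  then have "- (E *v x) \<le> ?u" "?u \<le> E *v x"
    by (auto simp: less_eq_vec_def abs_le_iff)
  then have "(x, ?u) \<in> feasible_set (dual_LP A B E s r)"
    using x0 x(2) by (simp add: dual_LP_def feedback_matrix_vector)
  then show "feasible (dual_LP A B E s r)"
    by (auto simp: feasible_def)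
qed

theorem lemma10:
  fixes A :: "real ^ 'n ^ 'n"
    and B :: "real ^ 'm ^ 'n"
    and E :: "real ^ 'n ^ 'm"
    and s :: "real ^ 'n"
    and r :: "real ^ 'm"
  assumes "0 \<le> E"
    and "\<forall>i. row i E \<noteq> 0"
    and "Metzler (A - \<bar>B\<bar> ** E)"
    and "s \<ge> transpose E *v \<bar>r\<bar>"
  shows "(finite_optimal_value (primal_LP A B E s r) \<longleftrightarrow> feasible (dual_LP A B E s r)) \<and>
    (feasible (dual_LP A B E s r) \<longleftrightarrow>
      (\<exists>D :: real ^ 'm ^ 'm. - mat 1 \<le> D \<and> D \<le> mat 1 \<and> Hurwitz (A - B ** D ** E)))"
  using primal_finite_iff_dual_feasible dual_feasible_iff_Hurwitz assms by blast

end
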